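(* Let $a,b,c\in\mathbb{R}$ with $b>a^2/3$, and let $x_1$ be the only real root of $p(x)=x^3+ax^2+bx+c$. Then: (I) if $a\ge 0$ and $c\le 0$, then $0\le x_1\le -c/b$; (II) if $a\ge 0$ and $c>0$, then $\min\{-a,-c/b\}\le x_1\le\max\{-a,-c/b\}$; (III) if $a<0$ and $c<0$, then $\min\{-a,-c/b\}\le x_1\le\max\{-a,-c/b\}$; (IV) if $a<0$ and $c\ge 0$, then $-c/b\le x_1\le 0$.
   Context: All coefficients are real. When $b>a^2/3$, the cubic $p$ has exactly one real root (and a pair of non-real complex conjugate roots), so $x_1$ is well defined. *)

theory Defs
  imports "HOL-Analysis.Analysis"
begin

definition cubic :: "real \<Rightarrow> real \<Rightarrow> real \<Rightarrow> real \<Rightarrow> real" where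
  "cubic a b c x = x ^ 3 + a * x ^ 2 + b * x + c"

(* Meaningful when there is exactly one real root, as is the case for b > a^2/3;
   using the value requires proving existence and uniqueness. *)
definition only_real_root :: "real \<Rightarrow> real \<Rightarrow> real \<Rightarrow> real" where
  "only_real_root a b c = (THE x. cubic a b c x = 0)"

end

theory Submission
  imports Defs
begin

text \<open>Write the cubic as \<open>p(x) = x\<^sup>2 (x + a) + (b x + c)\<close>. The first summand vanishes
  at \<open>-a\<close> and the second at \<open>-c/b\<close>, so \<open>p\<close> has weakly opposite signs at these two points and a root
  between them. In cases (I) and (IV) the sign of the root comes from \<open>x (x\<^sup>2 + a x + b) = -c\<close>,
  whose quadratic factor is positive.\<close>

text \<open>The discriminant in \<open>s\<close> is \<open>a ^ 2 - 3 * b\<close>, which is negative.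
  The coefficient 3/4 is the one that fits the difference quotient of the cubic at
  \<open>s = x + y\<close>.\<close>

lemma quadratic_pos:
  fixes a b s :: real
  assumes "b > a ^ 2 / 3"
  shows "3 / 4 * s ^ 2 + a * s + b > 0"
proof -
  have "3 / 4 * s ^ 2 + a * s + a ^ 2 / 3 = 3 / 4 * (s + 2 / 3 * a) ^ 2"
    by (simp add: power2_eq_square algebra_simps)
  then have "3 / 4 * s ^ 2 + a * s + a ^ 2 / 3 \<ge> 0"
    using zero_le_power2[of "s + 2 / 3 * a"] by linarith
  with assms show ?thesis by linarith
qed

text \<open>The difference of the two values is \<open>x - y\<close> times
  \<open>x ^ 2 + x * y + y ^ 2 + a * (x + y) + b\<close>, and \<open>x ^ 2 + x * y + y ^ 2 = 3 / 4 *
  (x + y) ^ 2 + (x - y) ^ 2 / 4\<close>.\<close>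

lemma cubic_inj:
  assumes b: "b > a ^ 2 / 3" and eq: "cubic a b c x = cubic a b c y"
  shows "x = y"
proof -
  have "(x - y) * ((3 / 4 * (x + y) ^ 2 + a * (x + y) + b) + (x - y) ^ 2 / 4) = 0"
    using eq unfolding cubic_def by (simp add: power2_eq_square power3_eq_cube field_simps)
  moreover have "(3 / 4 * (x + y) ^ 2 + a * (x + y) + b) + (x - y) ^ 2 / 4 > 0"
    using quadratic_pos[OF b, of "x + y"] by (simp add: add_pos_nonneg)
  ultimately show ?thesis by simp
qed

text \<open>Stating the intermediate value theorem with \<open>min\<close>, \<open>max\<close> and a
  product of values avoids cases on the order of \<open>u\<close>, \<open>v\<close> and on the
  signs.\<close>

lemma IVT_hull:
  fixes f :: "real \<Rightarrow> real"
  assumes cont: "continuous_on UNIV f" and sign: "f u * f v \<le> 0"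
  obtains x where "min u v \<le> x" "x \<le> max u v" "f x = 0"
proof -
  have "connected (f ` {min u v..max u v})"
    by (intro connected_continuous_image continuous_on_subset[OF cont]) auto
  moreover have "f u \<in> f ` {min u v..max u v}" "f v \<in> f ` {min u v..max u v}"
    by auto
  ultimately have "0 \<in> f ` {min u v..max u v}"
    using sign unfolding connected_iff_interval mult_le_0_iff by blast
  then show ?thesis using that by auto
qed

lemma cubic_root_between:
  assumes "b > 0"
  obtains x where "min (- a) (- c / b) \<le> x" "x \<le> max (- a) (- c / b)" "cubic a b c x = 0"
proof (rule IVT_hull)
  show "continuous_on UNIV (cubic a b c)"
    unfolding cubic_def by (intro continuous_intros)
  \<comment> \<open>The two values are \<open>- b * (a - c / b)\<close> and
    \<open>(c / b) ^ 2 * (a - c / b)\<close>.\<close>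
  have "cubic a b c (- a) * cubic a b c (- c / b) = - ((c / b) ^ 2 * b * (a - c / b) ^ 2)"
    using assms unfolding cubic_def by (simp add: power2_eq_square power3_eq_cube field_simps)
  then show "cubic a b c (- a) * cubic a b c (- c / b) \<le> 0"
    using assms by simp
qed

theorem theorem4:
  fixes a b c x1 :: real
  assumes "b > a ^ 2 / 3"
    and "x1 = only_real_root a b c"
  shows "(a \<ge> 0 \<and> c \<le> 0 \<longrightarrow> 0 \<le> x1 \<and> x1 \<le> - c / b) \<and>
         (a \<ge> 0 \<and> c > 0 \<longrightarrow> min (- a) (- c / b) \<le> x1 \<and> x1 \<le> max (- a) (- c / b)) \<and>
         (a < 0 \<and> c < 0 \<longrightarrow> min (- a) (- c / b) \<le> x1 \<and> x1 \<le> max (- a) (- c / b)) \<and>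
         (a < 0 \<and> c \<ge> 0 \<longrightarrow> - c / b \<le> x1 \<and> x1 \<le> 0)"
proof -
  have b: "b > 0" using quadratic_pos[OF assms(1), of 0] by simp
  obtain x where x: "min (- a) (- c / b) \<le> x" "x \<le> max (- a) (- c / b)"
    and root: "cubic a b c x = 0"
    using cubic_root_between[OF b] .
  have x1: "x1 = x"
    unfolding assms(2) only_real_root_def
    using root by (rule the_equality) (use root in \<open>metis cubic_inj[OF assms(1)]\<close>)
  \<comment> \<open>Taking \<open>s = x\<close> leaves the nonnegative remainder
    \<open>x ^ 2 / 4\<close>.\<close>
  have q: "x ^ 2 + a * x + b > 0"
    using quadratic_pos[OF assms(1), of x] zero_le_power2[of x] by linarith
  have e: "x * (x ^ 2 + a * x + b) = - c"
    using root unfolding cubic_def by (simp add: power2_eq_square power3_eq_cube algebra_simps)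
  have nonneg: "0 \<le> x" if "c \<le> 0"
    using e q that by (metis neg_0_le_iff_le zero_le_mult_iff not_less)
  have nonpos: "x \<le> 0" if "c \<ge> 0"
    using e q that by (metis neg_le_0_iff_le mult_le_0_iff not_less)
  show ?thesis
    unfolding x1
  proof (intro conjI impI; (elim conjE)?)
    \<comment> \<open>Here \<open>- a\<close> and \<open>- c / b\<close> lie on weakly opposite
      sides of 0, so the hull yields the bound \<open>- c / b\<close>; the bound 0 comes from
      \<open>nonneg\<close>.\<close>
    assume "a \<ge> 0" "c \<le> 0"
    then have "- c / b \<ge> 0" using b by (simp add: divide_nonpos_pos)
    with \<open>a \<ge> 0\<close> have "- a \<le> - c / b" by linarith
    then show "x \<le> - c / b" using x by simp
  next
    assume "a < 0" "c \<ge> 0"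
    then have "- c / b \<le> 0" using b by simp
    with \<open>a < 0\<close> have "- c / b \<le> - a" by linarith
    then show "- c / b \<le> x" using x by simp
  qed (use x nonneg nonpos in simp_all)
qed

end
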